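(* As $n\to\infty$, the law of $\tau^{(n)}/n^2$ converges weakly to the inverse exponential distribution $\mathsf{IE}(1)$, i.e. to the law with distribution function $F(x)=e^{-1/x}$ for $x>0$ (and $F(x)=0$ for $x\le 0$).
   Context: The $n$-detachment process ($n\ge1$): there are $n$ labeled passengers. At time $1$ all passengers sit in bus number $1$. At each integer time $k\ge 2$, a new bus with number $k$ becomes available and each passenger (currently sitting in one of the buses $1,\dots,k-1$), independently of the others and of the past, relocates to bus $k$ with probability $1/k$ and otherwise stays where they are. A passenger is lonely at time $k$ if no other passenger is in the same bus at time $k$; $L_k$ denotes the number of lonely passengers at time $k$. The time of permanent detachment is $\tau^{(n)}:=\min\{k\ge 1 : L_{k+j}=n\ \text{for all } j\ge 0\}$. $\mathsf{IE}(\lambda)$ denotes the law of $1/Z$ where $Z$ is exponentially distributed with parameter $\lambda$. *)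

theory Defs
  imports "HOL-Probability.Probability"
begin

text \<open>
  \<open>X k i \<omega>\<close> is the bus in which passenger \<open>i \<in> {1..n}\<close> sits at time \<open>k \<ge> 1\<close>; the values at
  time \<open>0\<close> and for other labels are irrelevant. Bus \<open>k\<close> is not available before time \<open>k\<close>, so
  passenger \<open>i\<close> relocates at time \<open>k\<close> exactly on the event \<open>X k i = k\<close>. The position of a
  passenger at time \<open>k - 1\<close> is determined by the relocation events before time \<open>k\<close>, hence
  relocating independently of the other passengers and of the past means that the whole family
  of relocation events is independent.
\<close>

locale detachment_process = prob_space M for M :: "'a measure" +
  fixes n :: nat and X :: "nat \<Rightarrow> nat \<Rightarrow> 'a \<Rightarrow> nat"
  assumes n_ge_1: "n \<ge> 1"
    and start: "\<And>i \<omega>. i \<in> {1..n} \<Longrightarrow> \<omega> \<in> space M \<Longrightarrow> X 1 i \<omega> = 1"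
    and move: "\<And>k i \<omega>. k \<ge> 2 \<Longrightarrow> i \<in> {1..n} \<Longrightarrow> \<omega> \<in> space M \<Longrightarrow>
      X k i \<omega> = k \<or> X k i \<omega> = X (k - 1) i \<omega>"
    and indep_relocations:
      "indep_events (\<lambda>(k, i). {\<omega> \<in> space M. X k i \<omega> = k}) ({2..} \<times> {1..n})"
    and prob_relocation: "\<And>k i. k \<ge> 2 \<Longrightarrow> i \<in> {1..n} \<Longrightarrow>
      prob {\<omega> \<in> space M. X k i \<omega> = k} = 1 / real k"

definition lonely :: "nat \<Rightarrow> (nat \<Rightarrow> nat \<Rightarrow> 'a \<Rightarrow> nat) \<Rightarrow> nat \<Rightarrow> 'a \<Rightarrow> nat \<Rightarrow> bool" where
  "lonely n X k \<omega> i \<longleftrightarrow> (\<forall>j\<in>{1..n}. j \<noteq> i \<longrightarrow> X k j \<omega> \<noteq> X k i \<omega>)"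

definition num_lonely :: "nat \<Rightarrow> (nat \<Rightarrow> nat \<Rightarrow> 'a \<Rightarrow> nat) \<Rightarrow> nat \<Rightarrow> 'a \<Rightarrow> nat" where
  "num_lonely n X k \<omega> = card {i \<in> {1..n}. lonely n X k \<omega> i}"

text \<open>
  The set below is nonempty almost surely: two given passengers move into the same new bus \<open>k\<close>
  with probability \<open>1 / k\<^sup>2\<close>, which is summable, and a passenger almost surely relocates
  infinitely often. On the exceptional null event the infimum takes the value \<open>0\<close>.
\<close>

definition detachment_time :: "nat \<Rightarrow> (nat \<Rightarrow> nat \<Rightarrow> 'a \<Rightarrow> nat) \<Rightarrow> 'a \<Rightarrow> nat" where
  "detachment_time n X \<omega> = Inf {k. k \<ge> 1 \<and> (\<forall>j. num_lonely n X (k + j) \<omega> = n)}"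

definition inverse_exponential :: "real \<Rightarrow> real measure" where
  "inverse_exponential l =
     distr (density lborel (\<lambda>z. ennreal (exponential_density l z))) borel (\<lambda>z. 1 / z)"

end

theory Submission
  imports Defs
begin

text \<open>
  Everybody is lonely at all times \<open>k \<ge> m\<close> iff the passengers sit in distinct buses at time \<open>m\<close>
  and at no later time two of them relocate simultaneously. The first event depends only on
  relocations up to time \<open>m\<close>, the second only on later ones, so they are independent. A passenger
  is in bus \<open>v\<close> at time \<open>m\<close> with probability \<open>1/v \<cdot> (1 - 1/(v+1)) \<cdots> (1 - 1/m) = 1/m\<close>, so the first event
  is a birthday problem, of probability \<open>exp (- n\<^sup>2/(2m) + o(1))\<close>. At most one passenger
  relocates at time \<open>k\<close> with probability about \<open>1 - n\<^sup>2/(2k\<^sup>2)\<close>; multiplied over \<open>k > m\<close> this is again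
  \<open>exp (- n\<^sup>2/(2m) + o(1))\<close>. With \<open>m = \<lfloor>x n\<^sup>2\<rfloor>\<close> the product of the two tends to \<open>exp (- 1/x)\<close>.
\<close>

section \<open>Estimates for the two factors\<close>

text \<open>The binomial probability \<open>(1 - 1/k)^n + (n/k) * (1 - 1/k)^(n-1)\<close> of at most
  one success in \<open>n\<close> trials, with the common power factored out.\<close>

definition at_most_one_prob :: "nat \<Rightarrow> nat \<Rightarrow> real" where
  "at_most_one_prob n k = (1 - 1 / real k) ^ (n - 1) * (1 + real (n - 1) / real k)"

text \<open>The birthday probability that \<open>n\<close> independent uniform choices among
  \<open>m\<close> places are distinct. For \<open>n > m >= 1\<close> the factor
  \<open>i = m\<close> makes it vanish.\<close>

definition distinct_prob :: "nat \<Rightarrow> nat \<Rightarrow> real" where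
  "distinct_prob n m = (\<Prod>i<n. 1 - real i / real m)"

text \<open>The difference of the two sides vanishes at 0 and has the nonnegative derivative
  \<open>t^2 / (1 + t)\<close>.\<close>

lemma ln_one_plus_ge_quadratic:
  fixes x :: real
  assumes "0 \<le> x"
  shows "x - x\<^sup>2 / 2 \<le> ln (1 + x)"
proof -
  have "ln (1 + 0) - 0 + 0\<^sup>2 / 2 \<le> ln (1 + x) - x + x\<^sup>2 / 2"
  proof (rule DERIV_nonneg_imp_nondecreasing[OF assms])
    fix t :: real assume t: "0 \<le> t" "t \<le> x"
    have "((\<lambda>t. ln (1 + t) - t + t\<^sup>2 / 2) has_real_derivative t\<^sup>2 / (1 + t)) (at t)"
      using t by (auto intro!: derivative_eq_intros simp: field_simps power2_eq_square)
    then show "\<exists>y. ((\<lambda>t. ln (1 + t) - t + t\<^sup>2 / 2) has_real_derivative y) (at t) \<and> 0 \<le> y"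
      using t by (intro exI[of _ "t\<^sup>2 / (1 + t)"]) simp
  qed
  then show ?thesis by simp
qed

text \<open>The same argument one order further, now with derivative
  \<open>t^3 / (1 + t)\<close>.\<close>

lemma ln_one_plus_le_cubic:
  fixes x :: real
  assumes "0 \<le> x"
  shows "ln (1 + x) \<le> x - x\<^sup>2 / 2 + x ^ 3 / 3"
proof -
  have "0 - 0\<^sup>2 / 2 + 0 ^ 3 / 3 - ln (1 + 0) \<le> x - x\<^sup>2 / 2 + x ^ 3 / 3 - ln (1 + x)"
  proof (rule DERIV_nonneg_imp_nondecreasing[OF assms])
    fix t :: real assume t: "0 \<le> t" "t \<le> x"
    have "((\<lambda>t. t - t\<^sup>2 / 2 + t ^ 3 / 3 - ln (1 + t)) has_real_derivative t ^ 3 / (1 + t)) (at t)"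
      using t by (auto intro!: derivative_eq_intros simp: field_simps power2_eq_square power3_eq_cube)
    then show "\<exists>y. ((\<lambda>t. t - t\<^sup>2 / 2 + t ^ 3 / 3 - ln (1 + t)) has_real_derivative y) (at t) \<and> 0 \<le> y"
      using t by (intro exI[of _ "t ^ 3 / (1 + t)"]) simp
  qed
  then show ?thesis by simp
qed

text \<open>Each term is at most \<open>1/(k-1) - 1/k\<close>, so the sum telescopes. The remainder
  \<open>- 1/N\<close> is dropped to get a bound uniform in \<open>N\<close>.\<close>

lemma sum_inverse_squares_le:
  assumes "m \<ge> 1"
  shows "(\<Sum>k\<in>{m<..N}. 1 / (real k)\<^sup>2) \<le> 1 / real m"
proof (cases "m \<le> N")
  case True
  then have "(\<Sum>k\<in>{m<..N}. 1 / (real k)\<^sup>2) \<le> 1 / real m - 1 / real N"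
  proof (induction N rule: dec_induct)
    case (step k)
    have "{m<..Suc k} = insert (Suc k) {m<..k}" using step by auto
    moreover have "1 / (real (Suc k))\<^sup>2 \<le> 1 / real k - 1 / real (Suc k)"
    proof -
      have "1 / (real (Suc k))\<^sup>2 \<le> 1 / (real k * real (Suc k))"
        using step assms by (intro frac_le) (auto simp: power2_eq_square)
      also have "\<dots> = 1 / real k - 1 / real (Suc k)"
        using step assms by (simp add: field_simps)
      finally show ?thesis .
    qed
    ultimately show ?case using step by simp
  qed simp
  then show ?thesis by (smt (verit) divide_nonneg_nonneg of_nat_0_le_iff)
qed simp

text \<open>Each term is at least \<open>1/k - 1/(k+1)\<close>. The remainder stays here and
  disappears only as \<open>N\<close> tends to infinity.\<close>

lemma sum_inverse_squares_ge:
  assumes "m \<le> N"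
  shows "1 / real (Suc m) - 1 / real (Suc N) \<le> (\<Sum>k\<in>{m<..N}. 1 / (real k)\<^sup>2)"
  using assms
proof (induction N rule: dec_induct)
  case (step k)
  have "{m<..Suc k} = insert (Suc k) {m<..k}" using step by auto
  moreover have "1 / real (Suc k) - 1 / real (Suc (Suc k)) \<le> 1 / (real (Suc k))\<^sup>2"
  proof -
    have "1 / real (Suc k) - 1 / real (Suc (Suc k)) = 1 / (real (Suc k) * real (Suc (Suc k)))"
      by (simp add: field_simps)
    also have "\<dots> \<le> 1 / (real (Suc k))\<^sup>2"
      by (intro frac_le) (auto simp: power2_eq_square)
    finally show ?thesis .
  qed
  ultimately show ?case using step by simp
qed simp

section \<open>The birthday factor\<close>

lemma sum_lessThan_of_nat: "(\<Sum>i<n. real i) = real n * (real n - 1) / 2"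
  by (induction n) (auto simp: field_simps)

text \<open>Take logarithms and use \<open>- y - 2 * y^2 <= ln (1 - y) <= - y\<close> for
  \<open>y = i/m\<close>, which \<open>2 * n <= m\<close> keeps below 1/2. The squares sum to at
  most \<open>n^3/m^2\<close>, a crude bound that is negligible for \<open>m\<close> of order
  \<open>n^2\<close>.\<close>

lemma distinct_prob_bounds:
  assumes "1 \<le> m" "2 * n \<le> m"
  shows "exp (- (real n * (real n - 1) / 2 / real m) - 2 * (real n ^ 3 / (real m)\<^sup>2)) \<le> distinct_prob n m"
    and "distinct_prob n m \<le> exp (- (real n * (real n - 1) / 2 / real m))"
proof -
  have half: "0 \<le> real i / real m" "real i / real m \<le> 1 / 2" if "i < n" for i
    using that assms by (auto simp: field_simps)
  have D: "distinct_prob n m = exp (\<Sum>i<n. ln (1 - real i / real m))"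
    unfolding distinct_prob_def exp_sum[OF finite_lessThan]
    using half by (intro prod.cong refl) (smt (verit) exp_ln field_sum_of_halves lessThan_iff)
  have s1: "(\<Sum>i<n. real i / real m) = real n * (real n - 1) / 2 / real m"
    by (simp add: sum_divide_distrib[symmetric] sum_lessThan_of_nat)
  have "(\<Sum>i<n. ln (1 - real i / real m)) \<le> (\<Sum>i<n. - (real i / real m))"
  proof (rule sum_mono)
    fix i assume "i \<in> {..<n}"
    then have "real i / real m < 1" using assms by (simp add: field_simps)
    then show "ln (1 - real i / real m) \<le> - (real i / real m)"
      by (intro ln_one_minus_pos_upper_bound) auto
  qed
  then show "distinct_prob n m \<le> exp (- (real n * (real n - 1) / 2 / real m))"
    by (simp only: D s1[symmetric] sum_negf exp_le_cancel_iff)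
  have "(\<Sum>i<n. (real i / real m)\<^sup>2) \<le> (\<Sum>i<n. (real n / real m)\<^sup>2)"
    by (intro sum_mono power_mono divide_right_mono) auto
  also have "\<dots> = real n ^ 3 / (real m)\<^sup>2"
    by (simp add: power_divide power2_eq_square power3_eq_cube)
  finally have s2: "(\<Sum>i<n. (real i / real m)\<^sup>2) \<le> real n ^ 3 / (real m)\<^sup>2" .
  have "- (\<Sum>i<n. real i / real m) - 2 * (\<Sum>i<n. (real i / real m)\<^sup>2) =
      (\<Sum>i<n. - (real i / real m) - 2 * (real i / real m)\<^sup>2)"
    by (simp add: sum_subtractf sum_negf sum_distrib_left)
  also have "\<dots> \<le> (\<Sum>i<n. ln (1 - real i / real m))"
    using half by (intro sum_mono ln_one_minus_pos_lower_bound) auto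
  finally show "exp (- (real n * (real n - 1) / 2 / real m) - 2 * (real n ^ 3 / (real m)\<^sup>2)) \<le> distinct_prob n m"
    using s2 unfolding D exp_le_cancel_iff s1 by linarith
qed

section \<open>The factor of the later relocations\<close>

lemma at_most_one_prob_eq_exp:
  assumes "k \<ge> 2"
  shows "at_most_one_prob n k =
    exp (real (n - 1) * ln (1 - 1 / real k) + ln (1 + real (n - 1) / real k))"
proof -
  have "1 - 1 / real k > 0" "1 + real (n - 1) / real k > 0"
    using assms by (auto intro: add_pos_nonneg)
  then show ?thesis
    unfolding at_most_one_prob_def by (simp add: exp_add exp_of_nat_mult)
qed

text \<open>With \<open>a = n - 1\<close> the first-order terms \<open>- a/k\<close> and
  \<open>a/k\<close> of the two logarithms cancel. What remains is \<open>a^2/2\<close> from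
  \<open>ln (1 + a/k)\<close> and the error \<open>2 * a\<close> from \<open>ln (1 - 1/k)\<close>,
  both over \<open>k^2\<close>.\<close>

lemma at_most_one_prob_ge:
  assumes "k \<ge> 2"
  shows "exp (- (((real (n - 1))\<^sup>2 / 2 + 2 * real (n - 1)) * (1 / (real k)\<^sup>2))) \<le> at_most_one_prob n k"
proof -
  define a where "a = real (n - 1)"
  have a: "a \<ge> 0" by (simp add: a_def)
  have "- (1 / real k) - 2 * (1 / real k)\<^sup>2 \<le> ln (1 - 1 / real k)"
    using assms by (intro ln_one_minus_pos_lower_bound) auto
  then have "a * (- (1 / real k) - 2 * (1 / real k)\<^sup>2) \<le> a * ln (1 - 1 / real k)"
    using a by (rule mult_left_mono)
  moreover have "a / real k - (a / real k)\<^sup>2 / 2 \<le> ln (1 + a / real k)"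
    using a by (intro ln_one_plus_ge_quadratic) auto
  moreover have "a * (- (1 / real k) - 2 * (1 / real k)\<^sup>2) + (a / real k - (a / real k)\<^sup>2 / 2)
      = - ((a\<^sup>2 / 2 + 2 * a) * (1 / (real k)\<^sup>2))"
    by (simp add: algebra_simps power_divide add_divide_distrib)
  ultimately show ?thesis
    unfolding at_most_one_prob_eq_exp[OF assms] exp_le_cancel_iff a_def[symmetric] by linarith
qed

text \<open>The first-order terms cancel as in the lower bound. The cubic error is turned into a
  multiple of \<open>1/k^2\<close>, so that only inverse squares have to be summed over
  \<open>k\<close>.\<close>

lemma at_most_one_prob_le:
  assumes "k > m" "m \<ge> 1"
  shows "at_most_one_prob n k \<le>
    exp (- ((real (n - 1))\<^sup>2 * (1 / 2 - real (n - 1) / (3 * real m)) * (1 / (real k)\<^sup>2)))"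
proof -
  define a where "a = real (n - 1)"
  have a: "a \<ge> 0" by (simp add: a_def)
  have "ln (1 - 1 / real k) \<le> - (1 / real k)"
    using assms by (intro ln_one_minus_pos_upper_bound) auto
  then have "a * ln (1 - 1 / real k) \<le> a * - (1 / real k)"
    using a by (rule mult_left_mono)
  moreover have "ln (1 + a / real k) \<le> a / real k - (a / real k)\<^sup>2 / 2 + (a / real k) ^ 3 / 3"
    using a by (intro ln_one_plus_le_cubic) auto
  \<comment> \<open>One of the three factors \<open>a/k\<close> is traded for the larger constant
    \<open>a/m\<close>, using \<open>k > m\<close>.\<close>
  moreover have "(a / real k) ^ 3 \<le> (a / real k)\<^sup>2 * (a / real m)"
    using assms a by (simp add: power3_eq_cube power2_eq_square mult_left_mono frac_le)
  moreover have "a * - (1 / real k) + (a / real k - (a / real k)\<^sup>2 / 2 + (a / real k)\<^sup>2 * (a / real m) / 3)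
      = - (a\<^sup>2 * (1 / 2 - a / (3 * real m)) * (1 / (real k)\<^sup>2))"
    by (simp add: algebra_simps power_divide)
  ultimately have "a * ln (1 - 1 / real k) + ln (1 + a / real k)
      \<le> - (a\<^sup>2 * (1 / 2 - a / (3 * real m)) * (1 / (real k)\<^sup>2))"
    by (smt (verit) divide_right_mono)
  moreover have "k \<ge> 2" using assms by simp
  ultimately show ?thesis
    by (simp only: at_most_one_prob_eq_exp exp_le_cancel_iff a_def[symmetric])
qed

lemma prod_at_most_one_prob_ge:
  assumes "m \<ge> 1"
  shows "exp (- (((real (n - 1))\<^sup>2 / 2 + 2 * real (n - 1)) / real m)) \<le> (\<Prod>k\<in>{m<..N}. at_most_one_prob n k)"
proof -
  define c where "c = (real (n - 1))\<^sup>2 / 2 + 2 * real (n - 1)"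
  have "c * (\<Sum>k\<in>{m<..N}. 1 / (real k)\<^sup>2) \<le> c * (1 / real m)"
    using sum_inverse_squares_le[OF assms] by (intro mult_left_mono) (auto simp: c_def)
  then have "exp (- (c / real m)) \<le> exp (\<Sum>k\<in>{m<..N}. - (c * (1 / (real k)\<^sup>2)))"
    by (simp add: sum_negf sum_distrib_left)
  also have "\<dots> = (\<Prod>k\<in>{m<..N}. exp (- (c * (1 / (real k)\<^sup>2))))"
    by (simp add: exp_sum)
  also have "\<dots> \<le> (\<Prod>k\<in>{m<..N}. at_most_one_prob n k)"
    unfolding c_def using assms by (intro prod_mono conjI at_most_one_prob_ge) auto
  finally show ?thesis by (simp add: c_def)
qed

lemma prod_at_most_one_prob_le:
  assumes "1 \<le> m" "2 * n \<le> m" "m \<le> N"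
  shows "(\<Prod>k\<in>{m<..N}. at_most_one_prob n k) \<le>
    exp (- ((real (n - 1))\<^sup>2 * (1 / 2 - real (n - 1) / (3 * real m)) * (1 / real (Suc m) - 1 / real (Suc N))))"
proof -
  define c where "c = (real (n - 1))\<^sup>2 * (1 / 2 - real (n - 1) / (3 * real m))"
  \<comment> \<open>This gives \<open>c >= 0\<close>, by which the lower bound for the sum of
    inverse squares can be scaled.\<close>
  have "real (n - 1) / (3 * real m) \<le> 1 / 2"
    using assms by (simp add: field_simps)
  then have "c \<ge> 0" by (simp add: c_def)
  have "(\<Prod>k\<in>{m<..N}. at_most_one_prob n k) \<le> (\<Prod>k\<in>{m<..N}. exp (- (c * (1 / (real k)\<^sup>2))))"
    unfolding c_def using assms
    by (intro prod_mono conjI at_most_one_prob_le) (auto simp: at_most_one_prob_def)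
  also have "\<dots> = exp (- (c * (\<Sum>k\<in>{m<..N}. 1 / (real k)\<^sup>2)))"
    by (simp add: exp_sum sum_negf[symmetric] sum_distrib_left)
  also have "\<dots> \<le> exp (- (c * (1 / real (Suc m) - 1 / real (Suc N))))"
    unfolding exp_le_cancel_iff neg_le_iff_le
    by (rule mult_left_mono[OF sum_inverse_squares_ge[OF assms(3)] \<open>c \<ge> 0\<close>])
  finally show ?thesis by (simp add: c_def)
qed

text \<open>The limit \<open>p\<close> will be the probability that everybody is lonely from time
  \<open>m\<close> on. The lower bound does not depend on \<open>N\<close>; in the upper one
  \<open>1 / Suc N\<close> tends to 0.\<close>

lemma detachment_prob_bounds:
  assumes "1 \<le> m" "2 * n \<le> m"
    and lim: "(\<lambda>N. distinct_prob n m * (\<Prod>k\<in>{m<..N}. at_most_one_prob n k)) \<longlonglongrightarrow> p"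
  shows "exp (- (real n * (real n - 1) / 2 / real m) - 2 * (real n ^ 3 / (real m)\<^sup>2))
      * exp (- (((real (n - 1))\<^sup>2 / 2 + 2 * real (n - 1)) / real m)) \<le> p" (is "?l1 * ?l2 \<le> p")
    and "p \<le> exp (- (real n * (real n - 1) / 2 / real m))
      * exp (- ((real (n - 1))\<^sup>2 * (1 / 2 - real (n - 1) / (3 * real m)) / real (Suc m)))" (is "p \<le> ?u1 * ?u2")
proof -
  note D = distinct_prob_bounds[OF assms(1,2)]
  have D0: "distinct_prob n m \<ge> 0" using D(1) by (smt (verit) exp_gt_zero)
  have "?l1 * ?l2 \<le> distinct_prob n m * (\<Prod>k\<in>{m<..N}. at_most_one_prob n k)" for N
    using D(1) D0 prod_at_most_one_prob_ge[OF assms(1)] by (intro mult_mono) auto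
  then show "?l1 * ?l2 \<le> p" by (intro LIMSEQ_le_const[OF lim]) auto
  have "(\<lambda>N. 1 / real (Suc m) - 1 / real (Suc N)) \<longlonglongrightarrow> 1 / real (Suc m) - 0"
    by (intro tendsto_diff tendsto_const LIMSEQ_Suc[OF lim_1_over_n])
  then have u: "(\<lambda>N. ?u1 * exp (- ((real (n - 1))\<^sup>2 * (1 / 2 - real (n - 1) / (3 * real m))
      * (1 / real (Suc m) - 1 / real (Suc N))))) \<longlonglongrightarrow>
      ?u1 * exp (- ((real (n - 1))\<^sup>2 * (1 / 2 - real (n - 1) / (3 * real m)) * (1 / real (Suc m) - 0)))"
    by (intro tendsto_mult tendsto_exp tendsto_minus tendsto_const)
  have "distinct_prob n m * (\<Prod>k\<in>{m<..N}. at_most_one_prob n k) \<le> ?u1 * exp (- ((real (n - 1))\<^sup>2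
      * (1 / 2 - real (n - 1) / (3 * real m)) * (1 / real (Suc m) - 1 / real (Suc N))))" if "N \<ge> m" for N
    using D(2) prod_at_most_one_prob_le[OF assms(1,2) that]
    by (intro mult_mono) (auto simp: at_most_one_prob_def intro!: prod_nonneg)
  then have "p \<le> ?u1 * exp (- ((real (n - 1))\<^sup>2 * (1 / 2 - real (n - 1) / (3 * real m)) * (1 / real (Suc m) - 0)))"
    by (intro LIMSEQ_le[OF lim u]) auto
  then show "p \<le> ?u1 * ?u2" by simp
qed

text \<open>All quantities are rewritten through \<open>h n = 1/n\<close>, which tends to 0, and the
  ratios \<open>r n\<close> and \<open>u n\<close> of \<open>n^2\<close> to \<open>f n\<close> and
  \<open>Suc (f n)\<close>, which tend to \<open>1/x\<close>. In each bound both exponential factors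
  tend to \<open>exp (- 1/(2x))\<close>.\<close>

lemma detachment_prob_bounds_tendsto:
  fixes x :: real and f :: "nat \<Rightarrow> nat"
  assumes x: "x > 0" and f: "(\<lambda>n. real (f n) / (real n)\<^sup>2) \<longlonglongrightarrow> x"
  shows "(\<lambda>n. exp (- (real n * (real n - 1) / 2 / real (f n)) - 2 * (real n ^ 3 / (real (f n))\<^sup>2))
      * exp (- (((real (n - 1))\<^sup>2 / 2 + 2 * real (n - 1)) / real (f n)))) \<longlonglongrightarrow> exp (- 1 / x)" (is ?l)
    and "(\<lambda>n. exp (- (real n * (real n - 1) / 2 / real (f n)))
      * exp (- ((real (n - 1))\<^sup>2 * (1 / 2 - real (n - 1) / (3 * real (f n))) / real (Suc (f n))))) \<longlonglongrightarrow> exp (- 1 / x)" (is ?u)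
proof -
  define r where "r n = (real n)\<^sup>2 / real (f n)" for n
  define h where "h n = 1 / real n" for n
  define u where "u n = (real n)\<^sup>2 / real (Suc (f n))" for n
  have h: "h \<longlonglongrightarrow> 0" unfolding h_def by (rule lim_1_over_n)
  have r: "r \<longlonglongrightarrow> 1 / x"
    using tendsto_divide[OF tendsto_const[of 1] f] x unfolding r_def by (auto simp: inverse_eq_divide)
  \<comment> \<open>This is the reciprocal of \<open>u n\<close>: the 1 added in
    \<open>Suc (f n)\<close> becomes \<open>h n * h n\<close> after division by
    \<open>n^2\<close>.\<close>
  have "(\<lambda>n. real (f n) / (real n)\<^sup>2 + h n * h n) \<longlonglongrightarrow> x + 0 * 0"
    by (intro tendsto_intros f h)
  then have "(\<lambda>n. 1 / (real (f n) / (real n)\<^sup>2 + h n * h n)) \<longlonglongrightarrow> 1 / (x + 0 * 0)"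
    using x by (intro tendsto_divide) auto
  moreover have "1 / (real (f n) / (real n)\<^sup>2 + h n * h n) = u n" for n
    by (simp add: u_def h_def power2_eq_square flip: add_divide_distrib)
  ultimately have u: "u \<longlonglongrightarrow> 1 / x" by simp
  have "(\<lambda>n. exp (- (r n * (1 - h n) / 2) - 2 * (r n * r n * h n)) * exp (- (r n * ((1 - h n)\<^sup>2 / 2 + 2 * (1 - h n) * h n))))
      \<longlonglongrightarrow> exp (- (1 / x * (1 - 0) / 2) - 2 * (1 / x * (1 / x) * 0)) * exp (- (1 / x * ((1 - 0)\<^sup>2 / 2 + 2 * (1 - 0) * 0)))"
    by (intro tendsto_intros r h) auto
  also have "exp (- (1 / x * (1 - 0) / 2) - 2 * (1 / x * (1 / x) * 0)) * exp (- (1 / x * ((1 - 0)\<^sup>2 / 2 + 2 * (1 - 0) * 0))) = exp (- 1 / x)"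
    by (simp flip: exp_add)
  finally show ?l
  proof (rule Lim_transform_eventually)
    show "\<forall>\<^sub>F n in sequentially. exp (- (r n * (1 - h n) / 2) - 2 * (r n * r n * h n)) * exp (- (r n * ((1 - h n)\<^sup>2 / 2 + 2 * (1 - h n) * h n)))
      = exp (- (real n * (real n - 1) / 2 / real (f n)) - 2 * (real n ^ 3 / (real (f n))\<^sup>2))
      * exp (- (((real (n - 1))\<^sup>2 / 2 + 2 * real (n - 1)) / real (f n)))"
      using eventually_gt_at_top[of 0]
    proof eventually_elim
      case (elim n)
      then have n: "real (n - 1) = real n - 1" "real n > 0" by auto
      have 1: "r n * (1 - h n) / 2 = real n * (real n - 1) / 2 / real (f n)"
        using n by (simp add: r_def h_def power2_eq_square right_diff_distrib diff_divide_distrib)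
      have 2: "r n * r n * h n = real n ^ 3 / (real (f n))\<^sup>2"
        using n by (simp add: r_def h_def power2_eq_square power3_eq_cube)
      have "(real n)\<^sup>2 * ((1 - h n)\<^sup>2 / 2 + 2 * (1 - h n) * h n) = (real (n - 1))\<^sup>2 / 2 + 2 * real (n - 1)"
        using n unfolding n by (simp add: h_def power2_eq_square field_simps)
      then have 3: "r n * ((1 - h n)\<^sup>2 / 2 + 2 * (1 - h n) * h n) = ((real (n - 1))\<^sup>2 / 2 + 2 * real (n - 1)) / real (f n)"
        by (simp add: r_def)
      show ?case unfolding 1 2 3 ..
    qed
  qed
  have "(\<lambda>n. exp (- (r n * (1 - h n) / 2)) * exp (- (u n * ((1 - h n)\<^sup>2 * (1 / 2 - r n * (1 - h n) * h n / 3)))))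
      \<longlonglongrightarrow> exp (- (1 / x * (1 - 0) / 2)) * exp (- (1 / x * ((1 - 0)\<^sup>2 * (1 / 2 - 1 / x * (1 - 0) * 0 / 3))))"
    by (intro tendsto_intros r h u) auto
  also have "exp (- (1 / x * (1 - 0) / 2)) * exp (- (1 / x * ((1 - 0)\<^sup>2 * (1 / 2 - 1 / x * (1 - 0) * 0 / 3)))) = exp (- 1 / x)"
    by (simp flip: exp_add)
  finally show ?u
  proof (rule Lim_transform_eventually)
    show "\<forall>\<^sub>F n in sequentially. exp (- (r n * (1 - h n) / 2)) * exp (- (u n * ((1 - h n)\<^sup>2 * (1 / 2 - r n * (1 - h n) * h n / 3))))
      = exp (- (real n * (real n - 1) / 2 / real (f n)))
      * exp (- ((real (n - 1))\<^sup>2 * (1 / 2 - real (n - 1) / (3 * real (f n))) / real (Suc (f n))))"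
      using eventually_gt_at_top[of 0]
    proof eventually_elim
      case (elim n)
      then have n: "real (n - 1) = real n - 1" "real n > 0" by auto
      have 1: "r n * (1 - h n) / 2 = real n * (real n - 1) / 2 / real (f n)"
        using n by (simp add: r_def h_def power2_eq_square right_diff_distrib diff_divide_distrib)
      have 2: "r n * (1 - h n) * h n / 3 = real (n - 1) / (3 * real (f n))"
      proof -
        have "(real n)\<^sup>2 * ((1 - h n) * h n) = real (n - 1)"
          using n unfolding n by (simp add: h_def power2_eq_square field_simps)
        then have "r n * ((1 - h n) * h n) = real (n - 1) / real (f n)"
          by (simp add: r_def)
        then show ?thesis by (simp add: mult.assoc)
      qed
      have 3: "u n * (1 - h n)\<^sup>2 = (real (n - 1))\<^sup>2 / real (Suc (f n))"
      proof -
        have "(real n)\<^sup>2 * (1 - h n)\<^sup>2 = (real (n - 1))\<^sup>2"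
          using n unfolding n by (simp add: h_def power2_eq_square field_simps)
        then show ?thesis by (simp add: u_def)
      qed
      have 4: "u n * ((1 - h n)\<^sup>2 * (1 / 2 - r n * (1 - h n) * h n / 3)) =
          (real (n - 1))\<^sup>2 * (1 / 2 - real (n - 1) / (3 * real (f n))) / real (Suc (f n))"
        unfolding 2 mult.assoc[symmetric] 3 by simp
      show ?case unfolding 1 4 ..
    qed
  qed
qed

section \<open>Independence of relocations\<close>

context prob_space
begin

text \<open>A single event forms an intersection-stable generator, so independence extends to the
  generated sigma algebras. These contain all preimages under a Boolean variable: the event, its
  complement, the whole space and the empty set.\<close>

lemma indep_vars_of_indep_events:
  assumes "indep_events (\<lambda>j. {\<omega> \<in> space M. P j \<omega>}) J"
  shows "indep_vars (\<lambda>_. count_space UNIV) P J"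
  unfolding indep_vars_def2
proof
  show "\<forall>j\<in>J. random_variable (count_space UNIV) (P j)"
    using assms by (auto simp: indep_events_def pred_def)
  have "indep_sets (\<lambda>j. sigma_sets (space M) {{\<omega> \<in> space M. P j \<omega>}}) J"
    using assms by (intro indep_sets_sigma) (auto simp: indep_events_def_alt Int_stable_def)
  then show "indep_sets (\<lambda>j. {P j -` A \<inter> space M |A. A \<in> sets (count_space UNIV)}) J"
  proof (rule indep_sets_mono_sets)
    fix j assume "j \<in> J"
    let ?E = "{\<omega> \<in> space M. P j \<omega>}"
    have E: "?E \<in> sigma_sets (space M) {?E}" by auto
    have "P j -` A \<inter> space M \<in> sigma_sets (space M) {?E}" for A
    proof -
      have "P j -` A \<inter> space M = (if True \<in> A then (if False \<in> A then space M else ?E)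
          else if False \<in> A then space M - ?E else {})"
      proof (rule set_eqI)
        fix x
        show "x \<in> P j -` A \<inter> space M \<longleftrightarrow> x \<in> (if True \<in> A then (if False \<in> A then space M else ?E)
          else if False \<in> A then space M - ?E else {})"
          by (cases "P j x") auto
      qed
      then show ?thesis
        using E sigma_sets.Compl[OF E] sigma_sets.Empty sigma_sets_top by auto
    qed
    then show "{P j -` A \<inter> space M |A. A \<in> sets (count_space UNIV)} \<subseteq> sigma_sets (space M) {?E}"
      by auto
  qed
qed

lemma prob_Ball_indep_vars:
  assumes "indep_vars (\<lambda>_. count_space UNIV) Z J" "finite J"
  shows "{\<omega> \<in> space M. \<forall>j\<in>J. P j (Z j \<omega>)} \<in> events"
    and "prob {\<omega> \<in> space M. \<forall>j\<in>J. P j (Z j \<omega>)} = (\<Prod>j\<in>J. prob {\<omega> \<in> space M. P j (Z j \<omega>)})"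
proof -
  have Z: "random_variable (count_space UNIV) (Z j)" if "j \<in> J" for j
    using assms that by (auto simp: indep_vars_def)
  have E: "Z j -` {z. P j z} \<inter> space M \<in> events" if "j \<in> J" for j
    using measurable_sets[OF Z[OF that], of "{z. P j z}"] by simp
  have eq: "{\<omega> \<in> space M. P j (Z j \<omega>)} = Z j -` {z. P j z} \<inter> space M" for j
    by auto
  show "{\<omega> \<in> space M. \<forall>j\<in>J. P j (Z j \<omega>)} \<in> events"
    using assms(2) E by (intro sets.sets_Collect_finite_All) (auto simp: eq)
  show "prob {\<omega> \<in> space M. \<forall>j\<in>J. P j (Z j \<omega>)} = (\<Prod>j\<in>J. prob {\<omega> \<in> space M. P j (Z j \<omega>)})"
  \<comment> \<open>The product rule \<open>indep_varsD\<close> asks for a nonempty index set; for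
    empty \<open>J\<close> the event is the whole space.\<close>
  proof (cases "J = {}")
    case True
    then show ?thesis by (simp add: prob_space)
  next
    case False
    have "{\<omega> \<in> space M. \<forall>j\<in>J. P j (Z j \<omega>)} = (\<Inter>j\<in>J. Z j -` {z. P j z} \<inter> space M)"
      using False by auto
    then show ?thesis
      using indep_varsD[OF assms(1) False assms(2) order_refl, of "\<lambda>j. {z. P j z}"] by (simp add: eq)
  qed
qed

end

text \<open>Telescoping of \<open>1/v * (v/(v+1)) * ... * ((m-1)/m)\<close>.\<close>

lemma prod_relocate_then_stay:
  assumes "1 \<le> v" "v \<le> m"
  shows "(\<Prod>l\<in>{v..m}. if l = v then 1 / real l else 1 - 1 / real l) = 1 / real m"
  using assms(2)
proof (induction m rule: dec_induct)
  case base
  show ?case by simp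
next
  case (step k)
  then show ?case
    using assms(1) by (simp add: atLeastAtMostSuc_conv field_simps)
qed

text \<open>A subset of \<open>{1..n}\<close> with \<open>n\<close> elements is all of it, and
  loneliness of everybody is injectivity.\<close>

lemma num_lonely_eq_iff:
  "num_lonely n X k \<omega> = n \<longleftrightarrow> inj_on (\<lambda>i. X k i \<omega>) {1..n}"
proof -
  have "num_lonely n X k \<omega> = n \<longleftrightarrow> {i \<in> {1..n}. lonely n X k \<omega> i} = {1..n}"
    unfolding num_lonely_def
    by (metis (no_types, lifting) card_atLeastAtMost card_subset_eq diff_Suc_1 finite_atLeastAtMost mem_Collect_eq subsetI)
  also have "\<dots> \<longleftrightarrow> inj_on (\<lambda>i. X k i \<omega>) {1..n}"
    by (auto simp: lonely_def inj_on_def set_eq_iff)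
  finally show ?thesis .
qed

section \<open>Positions as functions of the relocations\<close>

context detachment_process
begin

lemma position_in_range:
  assumes "k \<ge> 1" "i \<in> {1..n}" "\<omega> \<in> space M"
  shows "X k i \<omega> \<in> {1..k}"
  using assms(1)
proof (induction k rule: dec_induct)
  case base
  show ?case using start assms by simp
next
  case (step k)
  then show ?case using move[of "Suc k" i \<omega>] assms by auto
qed

text \<open>The current bus carries the time of the last relocation, or 1 if there was none. This
  exhibits the position as a function of the relocation indicators, as needed for grouping
  independent variables.\<close>

lemma position_eq_Max:
  assumes "m \<ge> 1" "i \<in> {1..n}" "\<omega> \<in> space M"
  shows "X m i \<omega> = Max (insert 1 {l \<in> {2..m}. X l i \<omega> = l})"
  using assms(1)
proof (induction m rule: dec_induct)
  case base
  show ?case using start assms by simp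
next
  case (step k)
  show ?case
  proof (cases "X (Suc k) i \<omega> = Suc k")
    case True
    then show ?thesis using step by (intro Max_eqI[symmetric]) auto
  next
    case False
    then have "X (Suc k) i \<omega> = X k i \<omega>"
      using move[of "Suc k" i \<omega>] step assms by auto
    moreover have "{l \<in> {2..Suc k}. X l i \<omega> = l} = {l \<in> {2..k}. X l i \<omega> = l}"
      using False by (auto simp: le_Suc_eq)
    ultimately show ?thesis using step by simp
  qed
qed

text \<open>Bus \<open>v\<close> is the current one iff the last relocation took place at time
  \<open>v\<close>. The range starts at \<open>max 2 v\<close> because sitting in bus 1 at time 1 is
  deterministic; for \<open>v = 1\<close> the condition says that no relocation occurred.\<close>

lemma position_eq_iff:
  assumes "1 \<le> v" "v \<le> m" "i \<in> {1..n}" "\<omega> \<in> space M"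
  shows "X m i \<omega> = v \<longleftrightarrow> (\<forall>l\<in>{max 2 v..m}. X l i \<omega> = l \<longleftrightarrow> l = v)"
  using assms(2)
proof (induction m rule: dec_induct)
  case base
  show ?case using start assms by (cases "v = 1") (auto simp: max_def)
next
  case (step k)
  have "X (Suc k) i \<omega> = Suc k \<or> X (Suc k) i \<omega> = X k i \<omega>"
    using move[of "Suc k" i \<omega>] step assms by auto
  moreover have "X k i \<omega> \<le> k"
    using position_in_range[of k i \<omega>] step assms by auto
  moreover have "{max 2 v..Suc k} = insert (Suc k) {max 2 v..k}"
    using step assms by auto
  ultimately show ?case using step by auto
qed

text \<open>Boolean variables in place of events make the rules for grouping and transforming
  independent variables applicable.\<close>

lemma indep_vars_relocation:
  "indep_vars (\<lambda>_. count_space UNIV) (\<lambda>(k, i) \<omega>. X k i \<omega> = k) ({2..} \<times> {1..n})"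
proof -
  have "(\<lambda>(k, i). {\<omega> \<in> space M. X k i \<omega> = k}) =
      (\<lambda>j. {\<omega> \<in> space M. (case j of (k, i) \<Rightarrow> \<lambda>\<omega>. X k i \<omega> = k) \<omega>})"
    by auto
  then show ?thesis
    using indep_relocations by (intro indep_vars_of_indep_events) simp
qed

lemma relocation_event:
  assumes "k \<ge> 2" "i \<in> {1..n}"
  shows "{\<omega> \<in> space M. X k i \<omega> = k} \<in> events"
proof -
  have "(\<lambda>(k, i). {\<omega> \<in> space M. X k i \<omega> = k}) ` ({2..} \<times> {1..n}) \<subseteq> events"
    using indep_relocations unfolding indep_events_def by (rule conjunct1)
  moreover have "(k, i) \<in> {2..} \<times> {1..n}" using assms by simp
  ultimately show ?thesis by blast
qed

lemma prob_relocation_pattern: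
  assumes "finite J" "J \<subseteq> {2..} \<times> {1..n}"
  shows "{\<omega> \<in> space M. \<forall>(k, i)\<in>J. X k i \<omega> = k \<longleftrightarrow> b k i} \<in> events"
    and "prob {\<omega> \<in> space M. \<forall>(k, i)\<in>J. X k i \<omega> = k \<longleftrightarrow> b k i} =
      (\<Prod>(k, i)\<in>J. if b k i then 1 / real k else 1 - 1 / real k)"
proof -
  let ?Y = "\<lambda>(k, i) \<omega>. X k i \<omega> = k"
  note indep = indep_vars_subset[OF indep_vars_relocation assms(2)]
  have eq: "{\<omega> \<in> space M. \<forall>(k, i)\<in>J. X k i \<omega> = k \<longleftrightarrow> b k i} =
      {\<omega> \<in> space M. \<forall>j\<in>J. ?Y j \<omega> \<longleftrightarrow> b (fst j) (snd j)}"
    by auto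
  show "{\<omega> \<in> space M. \<forall>(k, i)\<in>J. X k i \<omega> = k \<longleftrightarrow> b k i} \<in> events"
    unfolding eq by (rule prob_Ball_indep_vars(1)[OF indep assms(1)])
  have "prob {\<omega> \<in> space M. ?Y j \<omega> \<longleftrightarrow> b (fst j) (snd j)} =
      (case j of (k, i) \<Rightarrow> if b k i then 1 / real k else 1 - 1 / real k)" if "j \<in> J" for j
  proof -
    obtain k i where j: "j = (k, i)" by (cases j)
    with that assms have ki: "k \<ge> 2" "i \<in> {1..n}" by auto
    show ?thesis
      using prob_relocation[OF ki]
        prob_neg[OF relocation_event[OF ki]]
      by (simp add: j)
  qed
  note single = this
  show "prob {\<omega> \<in> space M. \<forall>(k, i)\<in>J. X k i \<omega> = k \<longleftrightarrow> b k i} =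
      (\<Prod>(k, i)\<in>J. if b k i then 1 / real k else 1 - 1 / real k)"
    unfolding eq
    by (subst prob_Ball_indep_vars(2)[OF indep assms(1)], rule prod.cong[OF refl]) (rule single)
qed

lemma prob_position:
  assumes "1 \<le> v" "v \<le> m" "i \<in> {1..n}"
  shows "prob {\<omega> \<in> space M. X m i \<omega> = v} = 1 / real m"
proof -
  have eq: "{\<omega> \<in> space M. X m i \<omega> = v} =
      {\<omega> \<in> space M. \<forall>(l, i)\<in>{max 2 v..m} \<times> {i}. X l i \<omega> = l \<longleftrightarrow> l = v}"
    using position_eq_iff[OF assms] by auto
  have "prob {\<omega> \<in> space M. X m i \<omega> = v} =
      (\<Prod>(l, i)\<in>{max 2 v..m} \<times> {i}. if l = v then 1 / real l else 1 - 1 / real l)"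
    unfolding eq using assms by (intro prob_relocation_pattern(2)) auto
  also have "\<dots> = (\<Prod>l\<in>{max 2 v..m}. if l = v then 1 / real l else 1 - 1 / real l)"
    by (simp add: prod.cartesian_product[symmetric])
  \<comment> \<open>The index added is at most \<open>l = 1\<close>, and only for
    \<open>v = 1\<close>, where the factor is \<open>1/1\<close>.\<close>
  also have "\<dots> = (\<Prod>l\<in>{v..m}. if l = v then 1 / real l else 1 - 1 / real l)"
  proof (rule prod.mono_neutral_left)
    show "\<forall>l\<in>{v..m} - {max 2 v..m}. (if l = v then 1 / real l else 1 - 1 / real l) = 1"
    proof
      fix l assume "l \<in> {v..m} - {max 2 v..m}"
      then have "l = 1" "v = 1" using assms by auto
      then show "(if l = v then 1 / real l else 1 - 1 / real l) = 1" by simp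
    qed
  qed (use assms in auto)
  finally show ?thesis using prod_relocate_then_stay[OF assms(1,2)] by simp
qed

text \<open>The event is split by the exact set \<open>S\<close> of relocating passengers, which is
  empty or a singleton; the pieces \<open>E S\<close> are disjoint relocation patterns.\<close>

lemma prob_at_most_one_relocation:
  assumes "k \<ge> 2"
  shows "prob {\<omega> \<in> space M. card {i \<in> {1..n}. X k i \<omega> = k} \<le> 1} = at_most_one_prob n k"
proof -
  define E where "E S = {\<omega> \<in> space M. \<forall>(l, i)\<in>{k} \<times> {1..n}. X l i \<omega> = l \<longleftrightarrow> i \<in> S}" for S
  define p where "p = 1 / real k"
  let ?T = "insert {} ((\<lambda>i. {i}) ` {1..n})"
  have E: "E S \<in> events" for S
    unfolding E_def by (rule prob_relocation_pattern) (use assms in auto)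
  have pE: "prob (E S) = (\<Prod>i\<in>{1..n}. if i \<in> S then p else 1 - p)" for S
  proof -
    have "prob (E S) = (\<Prod>(l, i)\<in>{k} \<times> {1..n}. if i \<in> S then 1 / real l else 1 - 1 / real l)"
      unfolding E_def by (rule prob_relocation_pattern) (use assms in auto)
    then show ?thesis unfolding p_def by (simp add: prod.cartesian_product[symmetric])
  qed
  have pE1: "prob (E {i}) = p * (1 - p) ^ (n - 1)" if "i \<in> {1..n}" for i
  proof -
    have "prob (E {i}) = p * (\<Prod>j\<in>{1..n} - {i}. 1 - p)"
      unfolding pE using that by (subst prod.remove[of _ i]) (auto intro!: prod.cong)
    then show ?thesis using that by simp
  qed
  have "{\<omega> \<in> space M. card {i \<in> {1..n}. X k i \<omega> = k} \<le> 1} = (\<Union>S\<in>?T. E S)"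
  proof -
    have "card {i \<in> {1..n}. X k i \<omega> = k} \<le> 1 \<longleftrightarrow> (\<exists>S\<in>?T. \<forall>i\<in>{1..n}. X k i \<omega> = k \<longleftrightarrow> i \<in> S)" for \<omega>
    proof
      assume "card {i \<in> {1..n}. X k i \<omega> = k} \<le> 1"
      then have "card {i \<in> {1..n}. X k i \<omega> = k} = 0 \<or> card {i \<in> {1..n}. X k i \<omega> = k} = 1"
        by linarith
      then consider "{i \<in> {1..n}. X k i \<omega> = k} = {}" | j where "{i \<in> {1..n}. X k i \<omega> = k} = {j}"
        by (auto simp: card_1_singleton_iff)
      then show "\<exists>S\<in>?T. \<forall>i\<in>{1..n}. X k i \<omega> = k \<longleftrightarrow> i \<in> S"
      proof cases
        case 1
        then have "\<forall>i\<in>{1..n}. X k i \<omega> = k \<longleftrightarrow> i \<in> {}" by blast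
        then show ?thesis by blast
      next
        case (2 j)
        then have "j \<in> {1..n}" by blast
        moreover have "\<forall>i\<in>{1..n}. X k i \<omega> = k \<longleftrightarrow> i \<in> {j}" using 2 by blast
        ultimately show ?thesis by blast
      qed
    next
      assume "\<exists>S\<in>?T. \<forall>i\<in>{1..n}. X k i \<omega> = k \<longleftrightarrow> i \<in> S"
      then obtain S where S: "S \<in> ?T" "{i \<in> {1..n}. X k i \<omega> = k} \<subseteq> S" by blast
      then have "card S \<le> 1" "finite S" by auto
      then show "card {i \<in> {1..n}. X k i \<omega> = k} \<le> 1"
        using card_mono[OF _ S(2)] by linarith
    qed
    then show ?thesis by (auto simp: E_def)
  qed
  moreover have "disjoint_family_on E ?T"
  proof (unfold disjoint_family_on_def, intro ballI impI)
    fix S S' assume "S \<in> ?T" "S' \<in> ?T" "S \<noteq> S'"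
    then have "S \<subseteq> {1..n}" "S' \<subseteq> {1..n}" by auto
    with \<open>S \<noteq> S'\<close> obtain i where "i \<in> {1..n}" "(i \<in> S) \<noteq> (i \<in> S')" by blast
    then show "E S \<inter> E S' = {}" by (auto simp: E_def)
  qed
  ultimately have "prob {\<omega> \<in> space M. card {i \<in> {1..n}. X k i \<omega> = k} \<le> 1} = (\<Sum>S\<in>?T. prob (E S))"
    using finite_measure_finite_Union[of ?T E] E by auto
  also have "\<dots> = prob (E {}) + (\<Sum>i\<in>{1..n}. prob (E {i}))"
    by (subst sum.insert) (auto simp: sum.reindex)
  also have "\<dots> = (1 - p) ^ n + real n * (p * (1 - p) ^ (n - 1))"
    by (simp add: pE1) (simp add: pE)
  also have "\<dots> = (1 - p) ^ (n - 1) * (1 - p + real n * p)"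
    using n_ge_1 by (cases n) (simp_all add: algebra_simps)
  also have "\<dots> = at_most_one_prob n k"
    using n_ge_1 by (simp add: at_most_one_prob_def p_def of_nat_diff diff_divide_distrib)
  finally show ?thesis .
qed

text \<open>After time \<open>m\<close> only simultaneous relocations are ruled out, not
  coincidences of positions. The conditions thus concern disjoint groups of relocations, and the
  horizon \<open>N\<close> keeps their number finite.\<close>

definition detached_until :: "nat \<Rightarrow> nat \<Rightarrow> 'a set" where
  "detached_until m N = {\<omega> \<in> space M. inj_on (\<lambda>i. X m i \<omega>) {1..n} \<and>
     (\<forall>k\<in>{m<..N}. card {i \<in> {1..n}. X k i \<omega> = k} \<le> 1)}"

lemma prob_detached_until:
  assumes m: "m \<ge> 1"
  shows "detached_until m N \<in> events"
    and "prob (detached_until m N) = distinct_prob n m * (\<Prod>k\<in>{m<..N}. at_most_one_prob n k)"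
proof -
  \<comment> \<open>The relocation events are grouped into blocks: \<open>Inl i\<close> collects those of passenger \<open>i\<close> up to
    time \<open>m\<close>, which determine the position at time \<open>m\<close>; \<open>Inr k\<close> collects those of all passengers at
    the later time \<open>k\<close>.\<close>
  define L where "L = {1..n} <+> {m<..N}"
  define K where "K j = (case j of Inl i \<Rightarrow> {2..m} \<times> {i} | Inr k \<Rightarrow> {k} \<times> {1..n})"
    for j :: "nat + nat"
  define g where "g j y = (case j of Inl i \<Rightarrow> Max (insert 1 {l \<in> {2..m}. y (l, i)})
      | Inr k \<Rightarrow> card {i \<in> {1..n}. y (k, i)})" for j :: "nat + nat" and y :: "nat \<times> nat \<Rightarrow> bool"
  define W where "W j \<omega> = g j (restrict (\<lambda>q. (case q of (k, i) \<Rightarrow> \<lambda>\<omega>. X k i \<omega> = k) \<omega>) (K j))"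
    for j \<omega>
  have finK: "finite (K j)" for j by (cases j) (auto simp: K_def)
  have "indep_vars (\<lambda>j. Pi\<^sub>M (K j) (\<lambda>_. count_space UNIV))
      (\<lambda>j \<omega>. restrict (\<lambda>q. (case q of (k, i) \<Rightarrow> \<lambda>\<omega>. X k i \<omega> = k) \<omega>) (K j)) L"
  proof (rule indep_vars_restrict[OF indep_vars_relocation])
    show "K j \<subseteq> {2..} \<times> {1..n}" if "j \<in> L" for j
      using that m by (auto simp: L_def K_def)
    \<comment> \<open>Blocks of different passengers differ in the label; the \<open>Inr\<close>
      blocks sit at different times, all after \<open>m\<close>.\<close>
    show "disjoint_family_on K L"
      by (auto simp: disjoint_family_on_def L_def K_def)
  qed
  \<comment> \<open>A finite product of Boolean count spaces is a count space, so every
    \<open>g j\<close> is measurable.\<close>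
  then have indep: "indep_vars (\<lambda>_. count_space UNIV) W L"
    unfolding W_def by (rule indep_vars_compose2)
      (subst count_space_PiM_finite; auto simp: finK)
  have finL: "finite L" by (simp add: L_def)
  have W_Inl: "W (Inl i) \<omega> = X m i \<omega>" if "i \<in> {1..n}" "\<omega> \<in> space M" for i \<omega>
  proof -
    have "W (Inl i) \<omega> = Max (insert 1 {l \<in> {2..m}. X l i \<omega> = l})"
      unfolding W_def g_def K_def by (simp cong: conj_cong)
    then show ?thesis using position_eq_Max[OF m that] by simp
  qed
  have W_Inr: "W (Inr k) \<omega> = card {i \<in> {1..n}. X k i \<omega> = k}" for k \<omega>
    unfolding W_def g_def K_def by (simp cong: conj_cong)
  \<comment> \<open>Injectivity couples all passengers. Fixing the whole placement \<open>f\<close>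
    at time \<open>m\<close> splits it into events \<open>E f\<close> that impose a separate
    condition on each block.\<close>
  define F where "F = {f \<in> {1..n} \<rightarrow>\<^sub>E {1..m}. inj_on f {1..n}}"
  define E where "E f = {\<omega> \<in> space M. \<forall>j\<in>L. case j of Inl i \<Rightarrow> W j \<omega> = f i | Inr k \<Rightarrow> W j \<omega> \<le> 1}"
    for f
  have E_Inl: "W (Inl i) \<omega> = f i" if "\<omega> \<in> E f" "i \<in> {1..n}" for \<omega> f i
  proof -
    have "Inl i \<in> L" using that(2) unfolding L_def by (rule InlI)
    with that(1) show ?thesis unfolding E_def by fastforce
  qed
  have E_alt: "E f = {\<omega> \<in> space M. \<forall>j\<in>L. (\<lambda>w. case j of Inl i \<Rightarrow> w = f i | Inr k \<Rightarrow> w \<le> 1) (W j \<omega>)}" for f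
    by (simp add: E_def)
  have E: "E f \<in> events" for f
    unfolding E_alt by (rule prob_Ball_indep_vars(1)[OF indep finL])
  have finF: "finite F" by (simp add: F_def finite_PiE)
  have eq: "detached_until m N = (\<Union>f\<in>F. E f)"
  proof (intro equalityI subsetI)
    fix \<omega> assume \<omega>: "\<omega> \<in> detached_until m N"
    then have sp: "\<omega> \<in> space M" by (simp add: detached_until_def)
    let ?f = "restrict (\<lambda>i. X m i \<omega>) {1..n}"
    have "?f \<in> F"
    proof -
      have "inj_on (\<lambda>i. X m i \<omega>) {1..n}" using \<omega> unfolding detached_until_def by blast
      then have "inj_on ?f {1..n}" by (simp only: inj_on_restrict_eq)
      moreover have "?f \<in> {1..n} \<rightarrow>\<^sub>E {1..m}" using position_in_range[OF m _ sp] unfolding restrict_PiE_iff by blast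
      ultimately show ?thesis unfolding F_def by blast
    qed
    moreover have "\<omega> \<in> E ?f"
    proof -
      have "case j of Inl i \<Rightarrow> W j \<omega> = ?f i | Inr k \<Rightarrow> W j \<omega> \<le> 1" if "j \<in> L" for j
      proof (cases j)
        case (Inl i)
        then have "i \<in> {1..n}" using that by (auto simp: L_def)
        then show ?thesis using W_Inl[OF _ sp] Inl by simp
      next
        case (Inr k)
        then have "k \<in> {m<..N}" using that by (auto simp: L_def)
        then show ?thesis using \<omega> Inr by (simp only: W_Inr detached_until_def sum.case mem_Collect_eq)
      qed
      then show ?thesis using sp unfolding E_def by blast
    qed
    ultimately show "\<omega> \<in> (\<Union>f\<in>F. E f)" by blast
  next
    fix \<omega> assume "\<omega> \<in> (\<Union>f\<in>F. E f)"
    then obtain f where f: "f \<in> F" "\<omega> \<in> E f" by blast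
    then have sp: "\<omega> \<in> space M" by (simp add: E_def)
    have "X m i \<omega> = f i" if "i \<in> {1..n}" for i
      using E_Inl[OF f(2) that] W_Inl[OF that sp] by simp
    moreover have "card {i \<in> {1..n}. X k i \<omega> = k} \<le> 1" if "k \<in> {m<..N}" for k
    proof -
      have "Inr k \<in> L" using that unfolding L_def by (rule InrI)
      with f(2) have "W (Inr k) \<omega> \<le> 1" unfolding E_def by fastforce
      then show ?thesis by (simp only: W_Inr)
    qed
    moreover have "inj_on f {1..n}" using f(1) unfolding F_def by blast
    ultimately show "\<omega> \<in> detached_until m N"
      using sp inj_on_cong[of "{1..n}" "\<lambda>i. X m i \<omega>" f] unfolding detached_until_def by blast
  qed
  show "detached_until m N \<in> events"
    unfolding eq using E finF by auto
  \<comment> \<open>The functions in \<open>F\<close> are extensional, so two different ones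
    disagree at some passenger in \<open>{1..n}\<close> and prescribe different positions for that
    passenger.\<close>
  have disj: "disjoint_family_on E F"
  proof (unfold disjoint_family_on_def, intro ballI impI)
    fix f f' assume f: "f \<in> F" "f' \<in> F" "f \<noteq> f'"
    then have "\<exists>i\<in>{1..n}. f i \<noteq> f' i"
      unfolding F_def by (metis (no_types, lifting) PiE_ext mem_Collect_eq)
    then show "E f \<inter> E f' = {}" using E_Inl by (metis disjoint_iff)
  qed
  \<comment> \<open>The value is the same for all \<open>f\<close> in \<open>F\<close>, so summation
    over \<open>F\<close> reduces to counting injections.\<close>
  have pE: "prob (E f) = (1 / real m) ^ n * (\<Prod>k\<in>{m<..N}. at_most_one_prob n k)" if "f \<in> F" for f
  proof -
    have "prob (E f) = (\<Prod>j\<in>L. prob {\<omega> \<in> space M. case j of Inl i \<Rightarrow> W j \<omega> = f i | Inr k \<Rightarrow> W j \<omega> \<le> 1})"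
      unfolding E_alt by (subst prob_Ball_indep_vars(2)[OF indep finL]) simp
    also have "\<dots> = (\<Prod>i\<in>{1..n}. prob {\<omega> \<in> space M. W (Inl i) \<omega> = f i}) *
        (\<Prod>k\<in>{m<..N}. prob {\<omega> \<in> space M. W (Inr k) \<omega> \<le> 1})"
      unfolding L_def by (subst prod.Plus) auto
    also have "(\<Prod>i\<in>{1..n}. prob {\<omega> \<in> space M. W (Inl i) \<omega> = f i}) = (\<Prod>i\<in>{1..n}. 1 / real m)"
    proof (rule prod.cong[OF refl])
      fix i assume i: "i \<in> {1..n}"
      then have "f i \<in> {1..m}" using that by (auto simp: F_def)
      then have "prob {\<omega> \<in> space M. X m i \<omega> = f i} = 1 / real m"
        using prob_position i by auto
      moreover have "{\<omega> \<in> space M. W (Inl i) \<omega> = f i} = {\<omega> \<in> space M. X m i \<omega> = f i}"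
        using W_Inl[OF i] by auto
      ultimately show "prob {\<omega> \<in> space M. W (Inl i) \<omega> = f i} = 1 / real m" by simp
    qed
    also have "(\<Prod>k\<in>{m<..N}. prob {\<omega> \<in> space M. W (Inr k) \<omega> \<le> 1}) =
        (\<Prod>k\<in>{m<..N}. at_most_one_prob n k)"
      using m by (intro prod.cong refl) (simp only: W_Inr, intro prob_at_most_one_relocation, auto)
    finally show ?thesis by simp
  qed
  have "real (card F) = (\<Prod>i<n. real (m - i))"
    using card_inj_on_subset_funcset[of "{1..n}" "{1..m}" "{1..n}"]
    by (simp add: F_def atLeast0LessThan)
  \<comment> \<open>The falling factorial uses truncated subtraction; for \<open>n > m\<close> both
    sides vanish because of the index \<open>i = m\<close>.\<close>
  also have "\<dots> = real m ^ n * distinct_prob n m"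
  proof (cases "n \<le> m")
    case True
    have "real m ^ n * distinct_prob n m = (\<Prod>i<n. real m * (1 - real i / real m))"
      unfolding distinct_prob_def prod.distrib by simp
    also have "\<dots> = (\<Prod>i<n. real (m - i))"
      using True m by (intro prod.cong) (auto simp: of_nat_diff field_simps)
    finally show ?thesis by simp
  next
    case False
    have "(\<Prod>i<n. real (m - i)) = 0" "distinct_prob n m = 0"
      using False m by (auto simp: distinct_prob_def intro!: bexI[of _ m])
    then show ?thesis by simp
  qed
  finally have cardF: "real (card F) = real m ^ n * distinct_prob n m" .
  have "prob (detached_until m N) = (\<Sum>f\<in>F. prob (E f))"
    unfolding eq using finite_measure_finite_Union[OF finF _ disj] E by auto
  also have "\<dots> = real (card F) * ((1 / real m) ^ n * (\<Prod>k\<in>{m<..N}. at_most_one_prob n k))"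
    by (simp add: pE)
  also have "\<dots> = distinct_prob n m * (\<Prod>k\<in>{m<..N}. at_most_one_prob n k)"
    using m by (simp add: cardF power_divide)
  finally show "prob (detached_until m N) = distinct_prob n m * (\<Prod>k\<in>{m<..N}. at_most_one_prob n k)" .
qed

section \<open>Permanent detachment\<close>

definition detached_from :: "nat \<Rightarrow> 'a set" where
  "detached_from m = {\<omega> \<in> space M. \<forall>k\<ge>m. num_lonely n X k \<omega> = n}"

text \<open>Two passengers who share a bus at time \<open>Suc k\<close> either both moved into the
  new bus or both stayed, and the latter contradicts distinctness at time \<open>k\<close>.\<close>

lemma inj_on_position_Suc_iff:
  assumes "k \<ge> 1" "\<omega> \<in> space M" "inj_on (\<lambda>i. X k i \<omega>) {1..n}"
  shows "inj_on (\<lambda>i. X (Suc k) i \<omega>) {1..n} \<longleftrightarrow> card {i \<in> {1..n}. X (Suc k) i \<omega> = Suc k} \<le> 1"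
proof -
  have mv: "X (Suc k) i \<omega> = Suc k \<or> X (Suc k) i \<omega> = X k i \<omega>" if "i \<in> {1..n}" for i
    using move[of "Suc k" i \<omega>] that assms(1,2) by auto
  have "finite {i \<in> {1..n}. X (Suc k) i \<omega> = Suc k}" by simp
  from card_le_Suc0_iff_eq[OF this]
  have "card {i \<in> {1..n}. X (Suc k) i \<omega> = Suc k} \<le> 1 \<longleftrightarrow>
      (\<forall>i\<in>{1..n}. \<forall>j\<in>{1..n}. X (Suc k) i \<omega> = Suc k \<longrightarrow> X (Suc k) j \<omega> = Suc k \<longrightarrow> i = j)"
    unfolding One_nat_def[symmetric] by blast
  also have "\<dots> \<longleftrightarrow> inj_on (\<lambda>i. X (Suc k) i \<omega>) {1..n}"
  proof
    assume *: "\<forall>i\<in>{1..n}. \<forall>j\<in>{1..n}. X (Suc k) i \<omega> = Suc k \<longrightarrow> X (Suc k) j \<omega> = Suc k \<longrightarrow> i = j"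
    show "inj_on (\<lambda>i. X (Suc k) i \<omega>) {1..n}"
    proof (rule inj_onI)
      fix i j assume ij: "i \<in> {1..n}" "j \<in> {1..n}" "X (Suc k) i \<omega> = X (Suc k) j \<omega>"
      show "i = j"
      proof (cases "X (Suc k) i \<omega> = Suc k")
        case True
        moreover from True have "X (Suc k) j \<omega> = Suc k" using ij(3) by simp
        ultimately show ?thesis using * ij(1,2) by blast
      next
        case False
        then have "X k i \<omega> = X k j \<omega>" using mv[OF ij(1)] mv[OF ij(2)] ij(3) by metis
        then show ?thesis using inj_onD[OF assms(3)] ij(1,2) by blast
      qed
    qed
  next
    assume inj: "inj_on (\<lambda>i. X (Suc k) i \<omega>) {1..n}"
    then show "\<forall>i\<in>{1..n}. \<forall>j\<in>{1..n}. X (Suc k) i \<omega> = Suc k \<longrightarrow> X (Suc k) j \<omega> = Suc k \<longrightarrow> i = j"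
      by (metis (mono_tags, lifting) inj_onD)
  qed
  finally show ?thesis by simp
qed

text \<open>Distinctness at time \<open>m\<close> propagates by induction on time as long as no two
  passengers move together.\<close>

lemma detached_from_eq:
  assumes "m \<ge> 1"
  shows "detached_from m = (\<Inter>N. detached_until m N)"
proof (intro equalityI subsetI)
  fix \<omega> assume "\<omega> \<in> detached_from m"
  then have sp: "\<omega> \<in> space M" and inj: "\<And>k. k \<ge> m \<Longrightarrow> inj_on (\<lambda>i. X k i \<omega>) {1..n}"
    by (auto simp: detached_from_def num_lonely_eq_iff)
  have "card {i \<in> {1..n}. X k i \<omega> = k} \<le> 1" if "k > m" for k
    using inj_on_position_Suc_iff[of "k - 1" \<omega>] inj[of k] inj[of "k - 1"] sp that assms
    by simp
  then show "\<omega> \<in> (\<Inter>N. detached_until m N)"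
    using sp inj by (auto simp: detached_until_def)
next
  fix \<omega> assume \<omega>: "\<omega> \<in> (\<Inter>N. detached_until m N)"
  then have sp: "\<omega> \<in> space M" by (auto simp: detached_until_def)
  have one: "card {i \<in> {1..n}. X k i \<omega> = k} \<le> 1" if "k > m" for k
  proof -
    have "\<omega> \<in> detached_until m k" "k \<in> {m<..k}" using \<omega> that by auto
    then show ?thesis unfolding detached_until_def by blast
  qed
  have "inj_on (\<lambda>i. X k i \<omega>) {1..n}" if "k \<ge> m" for k
    using that
  proof (induction k rule: dec_induct)
    case base
    then show ?case using \<omega> by (auto simp: detached_until_def)
  next
    case (step k)
    then show ?case using inj_on_position_Suc_iff[of k \<omega>] sp assms one[of "Suc k"] by simp
  qed
  then show "\<omega> \<in> detached_from m"
    using sp by (auto simp: detached_from_def num_lonely_eq_iff)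
qed

text \<open>The events \<open>detached_until m N\<close> decrease in \<open>N\<close>, so continuity
  from above applies.\<close>

lemma prob_detached_from:
  assumes "m \<ge> 1"
  shows "detached_from m \<in> events"
    and "(\<lambda>N. distinct_prob n m * (\<Prod>k\<in>{m<..N}. at_most_one_prob n k)) \<longlonglongrightarrow> prob (detached_from m)"
proof -
  note E = prob_detached_until(1)[OF assms]
  show "detached_from m \<in> events"
    unfolding detached_from_eq[OF assms] using E by auto
  have "decseq (detached_until m)"
    by (auto simp: decseq_def detached_until_def)
  then show "(\<lambda>N. distinct_prob n m * (\<Prod>k\<in>{m<..N}. at_most_one_prob n k)) \<longlonglongrightarrow> prob (detached_from m)"
    unfolding prob_detached_until(2)[OF assms, symmetric] detached_from_eq[OF assms]
    using E by (intro finite_Lim_measure_decseq) auto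
qed

end

section \<open>The limit law\<close>

text \<open>For \<open>x > 0\<close>, up to a null set \<open>1/z <= x\<close> means
  \<open>z > 1/x\<close>, whose probability is the exponential tail
  \<open>exp (- 1/x)\<close>.\<close>

lemma cdf_inverse_exponential:
  "cdf (inverse_exponential 1) x = (if x > 0 then exp (- 1 / x) else 0)"
proof -
  define N where "N = density lborel (\<lambda>z. ennreal (exponential_density 1 z))"
  interpret N: prob_space N unfolding N_def by (rule prob_space_exponential_density) simp
  have sN [simp, measurable_cong]: "sets N = sets borel" "space N = UNIV" by (auto simp: N_def)
  have "cdf (inverse_exponential 1) x = measure (distr N borel (\<lambda>z. 1 / z)) {..x}"
    by (simp add: cdf_def inverse_exponential_def N_def)
  also have "\<dots> = N.prob {z. 1 / z \<le> x}"
    by (subst measure_distr) (auto simp: vimage_def)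
  finally have cdf: "cdf (inverse_exponential 1) x = N.prob {z. 1 / z \<le> x}" .
  \<comment> \<open>Positivity allows \<open>1/z <= x\<close> to be inverted. Excluding
    \<open>c = 1/x\<close> reconciles the weak inequality with the strict one of the tail
    formula.\<close>
  have pos: "AE z in N. 0 < z \<and> z \<noteq> c" for c
  proof -
    have "AE z in lborel. z \<noteq> (0::real)" "AE z in lborel. z \<noteq> c" by (rule AE_lborel_singleton)+
    then have "AE z in lborel. 0 < ennreal (exponential_density 1 z) \<longrightarrow> 0 < z \<and> z \<noteq> c"
      by eventually_elim (auto simp: exponential_density_def split: if_splits)
    then show ?thesis unfolding N_def by (subst AE_density) auto
  qed
  show ?thesis
  proof (cases "x > 0")
    case True
    have "distributed N lborel (\<lambda>z. z) (exponential_density 1)"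
      unfolding distributed_def N_def by (auto intro!: distr_id2)
    from N.exponential_distributedD_gt[OF this, of "1 / x"] True
    have "N.prob {z. 1 / x < z} = exp (- 1 / x)" by simp
    moreover have "N.prob {z. 1 / z \<le> x} = N.prob {z. 1 / x < z}"
    proof (rule N.finite_measure_eq_AE)
      show "AE z in N. z \<in> {z. 1 / z \<le> x} \<longleftrightarrow> z \<in> {z. 1 / x < z}"
        using pos[of "1 / x"]
      proof eventually_elim
        case (elim z)
        then have "1 / x < z \<longleftrightarrow> 1 / x \<le> z" by auto
        also have "\<dots> \<longleftrightarrow> 1 / z \<le> x" using elim True by (simp add: field_simps)
        finally show ?case by simp
      qed
    qed auto
    ultimately show ?thesis using cdf True by simp
  next
    case False
    have "N.prob {z. 1 / z \<le> x} = N.prob {}"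
    proof (rule N.finite_measure_eq_AE)
      show "AE z in N. z \<in> {z. 1 / z \<le> x} \<longleftrightarrow> z \<in> {}"
        using pos[of 0]
      proof eventually_elim
        case (elim z)
        then have "0 < 1 / z" by simp
        then have "\<not> 1 / z \<le> x" using False by linarith
        then show ?case by simp
      qed
    qed auto
    then show ?thesis using cdf False by simp
  qed
qed

section \<open>The detachment time and its distribution function\<close>

context detachment_process
begin

text \<open>The exceptional event on which the infimum defining \<open>detachment_time\<close> is
  taken over the empty set.\<close>

definition never_detached :: "'a set" where
  "never_detached = space M - (\<Union>m\<in>{1..}. detached_from m)"

lemma never_detached_event: "never_detached \<in> events"
proof -
  have "(\<Union>m\<in>{1..}. detached_from m) \<in> events"
    by (intro sets.countable_UN'' prob_detached_from(1)) auto
  then show ?thesis unfolding never_detached_def by (rule sets.compl_sets)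
qed

text \<open>The lower bound for the probability of detachment from \<open>m\<close> on is reused
  with \<open>n\<close> fixed: it tends to 1 as \<open>m\<close> grows, and bounds the probability
  of the union from below.\<close>

lemma prob_never_detached: "prob never_detached = 0"
proof -
  let ?U = "\<Union>m\<in>{1..}. detached_from m"
  have U: "?U \<in> events"
    by (intro sets.countable_UN'' prob_detached_from(1)) auto
  define l where "l m = exp (- (real n * (real n - 1) / 2 / real m) - 2 * (real n ^ 3 / (real m)\<^sup>2))
      * exp (- (((real (n - 1))\<^sup>2 / 2 + 2 * real (n - 1)) / real m))" for m
  have inv: "(\<lambda>m. c / real m) \<longlonglongrightarrow> 0" for c
    by (rule lim_const_over_n)
  have "(\<lambda>m. real n ^ 3 / real m * (1 / real m)) \<longlonglongrightarrow> 0 * 0"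
    by (intro tendsto_mult inv)
  then have inv2: "(\<lambda>m. real n ^ 3 / (real m)\<^sup>2) \<longlonglongrightarrow> 0"
    by (simp add: power2_eq_square)
  have "l \<longlonglongrightarrow> exp (- 0 - 2 * 0) * exp (- 0)"
    unfolding l_def by (intro tendsto_intros inv inv2)
  then have "l \<longlonglongrightarrow> 1" by simp
  moreover have "l m \<le> prob ?U" if "m \<ge> 2 * n" for m
  proof -
    have m: "1 \<le> m" "2 * n \<le> m" using that n_ge_1 by auto
    have "l m \<le> prob (detached_from m)"
      unfolding l_def by (rule detachment_prob_bounds(1)[OF m prob_detached_from(2)[OF m(1)]])
    also have "\<dots> \<le> prob ?U"
      using m U by (intro finite_measure_mono) auto
    finally show ?thesis .
  qed
  ultimately have "1 \<le> prob ?U" by (intro LIMSEQ_le_const2) auto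
  then have "prob ?U = 1" by (simp add: antisym)
  then show ?thesis unfolding never_detached_def using prob_compl[OF U] by simp
qed

lemma detached_from_iff:
  assumes "\<omega> \<in> space M"
  shows "\<omega> \<in> detached_from k \<longleftrightarrow> (\<forall>j. num_lonely n X (k + j) \<omega> = n)"
proof -
  have "(\<forall>i\<ge>k. num_lonely n X i \<omega> = n) \<longleftrightarrow> (\<forall>j. num_lonely n X (k + j) \<omega> = n)"
    using le_Suc_ex[of k] le_add1[of k] by blast
  then show ?thesis using assms unfolding detached_from_def by blast
qed

text \<open>A nonempty set of naturals attains its infimum, and being in
  \<open>detached_from k\<close> persists when \<open>k\<close> increases.\<close>

lemma detachment_time_le_iff:
  assumes "\<omega> \<in> space M" "\<omega> \<notin> never_detached"
  shows "detachment_time n X \<omega> \<le> m \<longleftrightarrow> m \<ge> 1 \<and> \<omega> \<in> detached_from m"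
proof -
  define S where "S = {k. k \<ge> 1 \<and> \<omega> \<in> detached_from k}"
  have time: "detachment_time n X \<omega> = Inf S"
  proof -
    have "S = {k. k \<ge> 1 \<and> (\<forall>j. num_lonely n X (k + j) \<omega> = n)}"
      unfolding S_def detached_from_iff[OF assms(1)] ..
    then show ?thesis unfolding detachment_time_def by (simp only:)
  qed
  have "S \<noteq> {}" using assms by (auto simp: never_detached_def S_def)
  then have Inf: "Inf S \<in> S" by (rule Inf_nat_def1)
  show ?thesis
  proof
    assume "detachment_time n X \<omega> \<le> m"
    then show "m \<ge> 1 \<and> \<omega> \<in> detached_from m"
      using Inf by (auto simp: time S_def detached_from_def)
  next
    assume "m \<ge> 1 \<and> \<omega> \<in> detached_from m"
    then have "m \<in> S" by (simp add: S_def)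
    then show "detachment_time n X \<omega> \<le> m" unfolding time by (intro cInf_lower) auto
  qed
qed

lemma detachment_time_le_event: "{\<omega> \<in> space M. detachment_time n X \<omega> \<le> m} \<in> events"
proof -
  \<comment> \<open>On the null event the time is \<open>Inf {}\<close>, whose value is irrelevant.\<close>
  define c where "c = Inf ({} :: nat set)"
  have c: "detachment_time n X \<omega> = c" if "\<omega> \<in> never_detached" for \<omega>
  proof -
    have "{k. k \<ge> 1 \<and> (\<forall>j. num_lonely n X (k + j) \<omega> = n)} = {}"
      using that detached_from_iff[of \<omega>] unfolding never_detached_def by blast
    then show ?thesis unfolding detachment_time_def c_def by (simp only:)
  qed
  have sub: "never_detached \<subseteq> space M" by (auto simp: never_detached_def)
  \<comment> \<open>\<open>M\<close> is not assumed complete, so the null event is split off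
    explicitly; the time is constant on it.\<close>
  have "{\<omega> \<in> space M. detachment_time n X \<omega> \<le> m} =
      ((if m \<ge> 1 then detached_from m else {}) - never_detached) \<union> (if c \<le> m then never_detached else {})"
  proof (rule set_eqI)
    fix \<omega>
    have "detached_from m \<subseteq> space M" by (auto simp: detached_from_def)
    then show "\<omega> \<in> {\<omega> \<in> space M. detachment_time n X \<omega> \<le> m} \<longleftrightarrow>
        \<omega> \<in> ((if m \<ge> 1 then detached_from m else {}) - never_detached) \<union> (if c \<le> m then never_detached else {})"
      using sub c[of \<omega>] detachment_time_le_iff[of \<omega> m] by (cases "\<omega> \<in> never_detached") auto
  qed
  then show ?thesis using never_detached_event prob_detached_from(1)[of m] by simp
qed

lemma prob_detachment_time_le:
  "prob {\<omega> \<in> space M. detachment_time n X \<omega> \<le> m} = (if m \<ge> 1 then prob (detached_from m) else 0)"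
proof -
  have "never_detached \<in> null_sets M"
    using never_detached_event prob_never_detached by (auto simp: null_sets_def emeasure_eq_measure)
  then have ae: "AE \<omega> in M. \<omega> \<notin> never_detached" by (rule AE_not_in)
  have "prob {\<omega> \<in> space M. detachment_time n X \<omega> \<le> m} = prob (if m \<ge> 1 then detached_from m else {})"
  proof (rule finite_measure_eq_AE)
    show "AE \<omega> in M. \<omega> \<in> {\<omega> \<in> space M. detachment_time n X \<omega> \<le> m} \<longleftrightarrow>
        \<omega> \<in> (if m \<ge> 1 then detached_from m else {})"
      using ae AE_space by eventually_elim (simp add: detachment_time_le_iff)
  qed (use detachment_time_le_event prob_detached_from(1)[of m] in auto)
  then show ?thesis by simp
qed

lemma measurable_detachment_time [measurable]:
  "(\<lambda>\<omega>. real (detachment_time n X \<omega>)) \<in> borel_measurable M"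
  unfolding borel_measurable_iff_le
proof
  fix a :: real
  show "{\<omega> \<in> space M. real (detachment_time n X \<omega>) \<le> a} \<in> events"
  proof (cases "a \<ge> 0")
    case True
    then have "{\<omega> \<in> space M. real (detachment_time n X \<omega>) \<le> a} =
        {\<omega> \<in> space M. detachment_time n X \<omega> \<le> nat \<lfloor>a\<rfloor>}"
      by (auto simp: le_nat_iff le_floor_iff)
    then show ?thesis using detachment_time_le_event by simp
  next
    case False
    then have "{\<omega> \<in> space M. real (detachment_time n X \<omega>) \<le> a} = {}"
      by (auto simp: not_le intro: less_le_trans)
    then show ?thesis by (simp only: sets.empty_sets)
  qed
qed

text \<open>The time is a natural number, so the threshold may be rounded down. The value
  \<open>nat\<close> gives for negative numbers is 0, which fits the zero branch.\<close>

lemma cdf_detachment_time: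
  "cdf (distr M borel (\<lambda>\<omega>. real (detachment_time n X \<omega>) / (real n)\<^sup>2)) x =
    (if nat \<lfloor>x * (real n)\<^sup>2\<rfloor> \<ge> 1 then prob (detached_from (nat \<lfloor>x * (real n)\<^sup>2\<rfloor>)) else 0)"
proof -
  have "cdf (distr M borel (\<lambda>\<omega>. real (detachment_time n X \<omega>) / (real n)\<^sup>2)) x =
      prob {\<omega> \<in> space M. real (detachment_time n X \<omega>) / (real n)\<^sup>2 \<le> x}"
    unfolding cdf_def by (subst measure_distr) (auto intro!: arg_cong[where f = prob])
  also have "{\<omega> \<in> space M. real (detachment_time n X \<omega>) / (real n)\<^sup>2 \<le> x} =
      {\<omega> \<in> space M. real (detachment_time n X \<omega>) \<le> x * (real n)\<^sup>2}"
    using n_ge_1 by (simp add: pos_divide_le_eq)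
  also have "prob \<dots> = (if nat \<lfloor>x * (real n)\<^sup>2\<rfloor> \<ge> 1 then prob (detached_from (nat \<lfloor>x * (real n)\<^sup>2\<rfloor>)) else 0)"
  proof (cases "x \<ge> 0")
    case True
    then have "{\<omega> \<in> space M. real (detachment_time n X \<omega>) \<le> x * (real n)\<^sup>2} =
        {\<omega> \<in> space M. detachment_time n X \<omega> \<le> nat \<lfloor>x * (real n)\<^sup>2\<rfloor>}"
      by (auto simp: le_nat_iff le_floor_iff)
    then show ?thesis using prob_detachment_time_le by simp
  next
    case False
    then have neg: "x * (real n)\<^sup>2 < 0" using n_ge_1 by (simp add: mult_neg_pos)
    then have "{\<omega> \<in> space M. real (detachment_time n X \<omega>) \<le> x * (real n)\<^sup>2} = {}"
      by (auto simp: not_le intro: less_le_trans)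
    moreover have "nat \<lfloor>x * (real n)\<^sup>2\<rfloor> = 0" using neg by simp
    ultimately show ?thesis by (simp only: measure_empty) simp
  qed
  finally show ?thesis .
qed

end

section \<open>Weak convergence by squeezing the distribution functions\<close>

theorem theorem3p2:
  fixes M :: "nat \<Rightarrow> 'a measure"
    and X :: "nat \<Rightarrow> nat \<Rightarrow> nat \<Rightarrow> 'a \<Rightarrow> nat"
  assumes "\<And>n. n \<ge> 1 \<Longrightarrow> detachment_process (M n) n (X n)"
  shows "weak_conv_m
           (\<lambda>n. distr (M n) borel (\<lambda>\<omega>. real (detachment_time n (X n) \<omega>) / (real n)\<^sup>2))
           (inverse_exponential 1)
         \<and> (\<forall>x. cdf (inverse_exponential 1) x = (if x > 0 then exp (- 1 / x) else 0))"
proof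
  show cdf: "\<forall>x. cdf (inverse_exponential 1) x = (if x > 0 then exp (- 1 / x) else 0)"
    using cdf_inverse_exponential by blast
  show "weak_conv_m
       (\<lambda>n. distr (M n) borel (\<lambda>\<omega>. real (detachment_time n (X n) \<omega>) / (real n)\<^sup>2))
       (inverse_exponential 1)"
    unfolding weak_conv_m_def weak_conv_def
  proof (intro allI impI)
    fix x :: real
    let ?F = "\<lambda>n. cdf (distr (M n) borel (\<lambda>\<omega>. real (detachment_time n (X n) \<omega>) / (real n)\<^sup>2)) x"
    define f where "f n = nat \<lfloor>x * (real n)\<^sup>2\<rfloor>" for n :: nat
    have F: "?F n = (if f n \<ge> 1 then measure (M n) (detachment_process.detached_from (M n) n (X n) (f n)) else 0)"
      if "n \<ge> 1" for n
      unfolding f_def by (rule detachment_process.cdf_detachment_time[OF assms[OF that]])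
    show "?F \<longlonglongrightarrow> cdf (inverse_exponential 1) x"
    proof (cases "x > 0")
      case False
      then have "x * (real n)\<^sup>2 \<le> 0" for n :: nat by (simp add: mult_nonpos_nonneg)
      then have "f n = 0" for n by (simp add: f_def floor_le_iff order.strict_trans1[OF _ zero_less_one])
      \<comment> \<open>For a threshold rounded to 0 the distribution function is in its zero
        branch. The formula \<open>F\<close> covers \<open>n >= 1\<close> only, hence the eventual
        equality.\<close>
      then have "\<forall>\<^sub>F n in sequentially. 0 = ?F n"
        using F by (intro eventually_sequentiallyI[of 1]) simp
      then have "?F \<longlonglongrightarrow> 0" by (rule Lim_transform_eventually[OF tendsto_const])
      then show ?thesis using False cdf by simp
    next
      case True
      have floor: "x * (real n)\<^sup>2 - 1 \<le> real (f n)" "real (f n) \<le> x * (real n)\<^sup>2" for n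
      proof -
        have "real (f n) = of_int \<lfloor>x * (real n)\<^sup>2\<rfloor>" using True by (simp add: f_def)
        then show "x * (real n)\<^sup>2 - 1 \<le> real (f n)" "real (f n) \<le> x * (real n)\<^sup>2" by linarith+
      qed
      have "(\<lambda>n. real (f n) / (real n)\<^sup>2) \<longlonglongrightarrow> x"
      proof (rule tendsto_sandwich)
        \<comment> \<open>Rounding down loses at most 1, that is \<open>1/n^2\<close> after
          scaling.\<close>
        have "(\<lambda>n. x - 1 / real n * (1 / real n)) \<longlonglongrightarrow> x - 0 * 0"
          by (intro tendsto_intros lim_1_over_n)
        then show "(\<lambda>n. x - 1 / real n * (1 / real n)) \<longlonglongrightarrow> x" by simp
        show "\<forall>\<^sub>F n in sequentially. x - 1 / real n * (1 / real n) \<le> real (f n) / (real n)\<^sup>2"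
          using eventually_ge_at_top[of 1]
        proof eventually_elim
          case (elim n)
          then have "x - 1 / real n * (1 / real n) = (x * (real n)\<^sup>2 - 1) / (real n)\<^sup>2"
            by (simp add: diff_divide_distrib power2_eq_square)
          also have "\<dots> \<le> real (f n) / (real n)\<^sup>2" using floor(1) by (intro divide_right_mono) auto
          finally show ?case .
        qed
        show "\<forall>\<^sub>F n in sequentially. real (f n) / (real n)\<^sup>2 \<le> x"
          using floor(2) by (intro eventually_sequentiallyI[of 1]) (simp add: pos_divide_le_eq)
      qed (rule tendsto_const)
      note lims = detachment_prob_bounds_tendsto[OF True this]
      \<comment> \<open>From \<open>n >= 3/x\<close> follows \<open>x * n^2 >= 3 * n\<close>, hence
        \<open>f n >= 3 * n - 1 >= 2 * n\<close>; the third \<open>n\<close> pays for the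
        rounding.\<close>
      have ev: "\<forall>\<^sub>F n in sequentially. n \<ge> 1 \<and> 1 \<le> f n \<and> 2 * n \<le> f n"
        using eventually_ge_at_top[of "nat \<lceil>3 / x\<rceil>"] eventually_ge_at_top[of 1]
      proof eventually_elim
        case (elim n)
        then have "3 / x \<le> real n" by linarith
        then have "3 \<le> x * real n" using True by (simp add: field_simps)
        then have "3 * real n \<le> x * (real n)\<^sup>2" by (simp add: power2_eq_square mult_right_mono flip: mult.assoc)
        then have "2 * real n \<le> real (f n)" using floor(1)[of n] elim by linarith
        then show ?case using elim by linarith
      qed
      have "?F \<longlonglongrightarrow> exp (- 1 / x)"
      proof (rule tendsto_sandwich[OF _ _ lims])
        show "\<forall>\<^sub>F n in sequentially. exp (- (real n * (real n - 1) / 2 / real (f n)) - 2 * (real n ^ 3 / (real (f n))\<^sup>2))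
            * exp (- (((real (n - 1))\<^sup>2 / 2 + 2 * real (n - 1)) / real (f n))) \<le> ?F n"
          using ev
        proof eventually_elim
          case (elim n)
          interpret detachment_process "M n" n "X n" using assms elim by blast
          have f: "1 \<le> f n" "2 * n \<le> f n" and F': "?F n = prob (detached_from (f n))"
            using elim F[of n] by auto
          show ?case
            unfolding F' by (rule detachment_prob_bounds(1)[OF f prob_detached_from(2)[OF f(1)]])
        qed
        show "\<forall>\<^sub>F n in sequentially. ?F n \<le> exp (- (real n * (real n - 1) / 2 / real (f n)))
            * exp (- ((real (n - 1))\<^sup>2 * (1 / 2 - real (n - 1) / (3 * real (f n))) / real (Suc (f n))))"
          using ev
        proof eventually_elim
          case (elim n)
          interpret detachment_process "M n" n "X n" using assms elim by blast
          have f: "1 \<le> f n" "2 * n \<le> f n" and F': "?F n = prob (detached_from (f n))"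
            using elim F[of n] by auto
          show ?case
            unfolding F' by (rule detachment_prob_bounds(2)[OF f prob_detached_from(2)[OF f(1)]])
        qed
      qed
      then show ?thesis using True cdf by simp
    qed
  qed
qed

end
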